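(* For every integer $q$ that is a power of $3$ (i.e. $q=3^m$ with $m\ge 1$) and every integer $k\ge 2$, there exists a 3-partite 3-graph $\mathrm{D}_3(k,q)$ such that the following hold. 1. $\mathrm{D}_3(k,q)$ has $3q^k$ vertices and $q^{2k+1}$ edges. 2. If $k\le 6$, the link graphs of all vertices of $\mathrm{D}_3(k,q)$ are isomorphic to one another. 3. $\mathrm{D}_3(3,q)$ is $\widetilde C_6$-free, and $\mathrm{D}_3(5,q)$ is $\widetilde C_8$-free.
   Context: A 3-graph (3-uniform hypergraph) on a vertex set $V$ is a set of 3-element subsets of $V$, called (hyper)edges. It is 3-partite if $V$ can be partitioned into three parts such that each edge contains exactly one vertex of each part. For 3-graphs $G$ and $H$, $G$ is $H$-free if $G$ contains no (not necessarily induced) subgraph isomorphic to $H$. For a 3-graph $H$ and $x\in V(H)$, the link graph $L_{x,H}$ is the graph with vertex set $V(H)\setminus\{x\}$ and edge set $\{uv:\{x,u,v\}\in H\}$. $C_{2k}$ is the cycle with $2k$ vertices. For a graph $G$, the hypergraph suspension $\widetilde G$ is the 3-graph obtained by adding one new vertex $x$ to $V(G)$ and taking as hyperedges the sets $e\cup\{x\}$ for $e\in E(G)$. *)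

theory Defs
  imports Main
begin

record 'a hypergraph =
  verts :: "'a set"
  hedges :: "'a set set"

text \<open>Graphs are the case \<open>r = 2\<close>, 3-graphs the case \<open>r = 3\<close>.\<close>

definition uniform_hypergraph :: "nat \<Rightarrow> 'a hypergraph \<Rightarrow> bool" where
  "uniform_hypergraph r G \<longleftrightarrow> (\<forall>e\<in>hedges G. e \<subseteq> verts G \<and> card e = r)"

definition three_partite :: "'a hypergraph \<Rightarrow> bool" where
  "three_partite G \<longleftrightarrow>
     (\<exists>A B C. A \<union> B \<union> C = verts G \<and> A \<inter> B = {} \<and> A \<inter> C = {} \<and> B \<inter> C = {} \<and>
        (\<forall>e\<in>hedges G. card (e \<inter> A) = 1 \<and> card (e \<inter> B) = 1 \<and> card (e \<inter> C) = 1))"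

definition subhypergraph :: "'a hypergraph \<Rightarrow> 'a hypergraph \<Rightarrow> bool" where
  "subhypergraph S G \<longleftrightarrow>
     verts S \<subseteq> verts G \<and> hedges S \<subseteq> hedges G \<and> (\<forall>e\<in>hedges S. e \<subseteq> verts S)"

definition isomorphic :: "'a hypergraph \<Rightarrow> 'b hypergraph \<Rightarrow> bool" where
  "isomorphic G H \<longleftrightarrow>
     (\<exists>f. bij_betw f (verts G) (verts H) \<and> hedges H = (\<lambda>e. f ` e) ` hedges G)"

definition is_free :: "'b hypergraph \<Rightarrow> 'a hypergraph \<Rightarrow> bool" where
  "is_free H G \<longleftrightarrow> \<not> (\<exists>S. subhypergraph S G \<and> isomorphic S H)"

text \<open>For a 3-graph \<open>H\<close>, the condition \<open>{x, u, v} \<in> hedges H\<close> already forces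
  \<open>x\<close>, \<open>u\<close>, \<open>v\<close> to be distinct. If \<open>H\<close> is 3-partite, the other vertices in the part of \<open>x\<close> remain
  as isolated vertices of the link.\<close>

definition link_graph :: "'a \<Rightarrow> 'a hypergraph \<Rightarrow> 'a hypergraph" where
  "link_graph x H =
     \<lparr>verts = verts H - {x}, hedges = {{u, v} | u v. {x, u, v} \<in> hedges H}\<rparr>"

text \<open>This is a simple cycle only for \<open>n \<ge> 3\<close>.\<close>

definition cycle_graph :: "nat \<Rightarrow> nat hypergraph" where
  "cycle_graph n = \<lparr>verts = {..<n}, hedges = {{i, (i + 1) mod n} | i. i < n}\<rparr>"

text \<open>The new vertex is \<open>None\<close>; the old vertices are embedded by \<open>Some\<close>.\<close>

definition suspension :: "'a hypergraph \<Rightarrow> 'a option hypergraph" where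
  "suspension G =
     \<lparr>verts = insert None (Some ` verts G),
      hedges = (\<lambda>e. insert None (Some ` e)) ` hedges G\<rparr>"

end

theory Submission
  imports Defs "HOL-Library.FuncSet" "HOL-Algebra.Algebraic_Closure_Type"
    "Berlekamp_Zassenhaus.Finite_Field"
begin

text \<open>
  Let \<open>K\<close> be the field with \<open>q\<close> elements. Each part of the hypergraph is a copy of \<open>K\<^sup>k\<close>, and points
  \<open>x, y, z\<close> of the three parts form an edge if for every coordinate \<open>i \<ge> 1\<close>

  \<open>x\<^sub>i + y\<^sub>i + z\<^sub>i = f\<^sub>i(x,y) + f\<^sub>i(y,z) + f\<^sub>i(z,x)\<close>,

  where \<open>f\<^sub>1, ..., f\<^sub>4\<close> are \<open>x\<^sub>0y\<^sub>0\<close>, \<open>x\<^sub>0\<^sup>2y\<^sub>0\<close>, \<open>x\<^sub>0y\<^sub>0\<^sup>2\<close>, \<open>x\<^sub>0y\<^sub>0x\<^sub>1\<close> and all later \<open>f\<^sub>i\<close> vanish. Since \<open>f\<^sub>i\<close>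
  involves only coordinates below \<open>i\<close>, an edge is determined by \<open>x\<close>, \<open>y\<close> and an arbitrary \<open>z\<^sub>0\<close>,
  which gives \<open>q\<^sup>k q\<^sup>k q\<close> edges.

  The system is invariant under rotating the three parts. For fixed \<open>z\<close>, the terms involving \<open>z\<close>
  can be removed by a change of coordinates on \<open>x\<close> and on \<open>y\<close> (\<open>incident_shear\<close>), so every link is
  isomorphic to the link of the origin of the third part, which is the graph \<open>x\<^sub>i + y\<^sub>i = f\<^sub>i(x,y)\<close>
  together with isolated vertices (\<open>link_straightening\<close>).

  A suspended cycle in the hypergraph is a cycle in some link, hence a cycle in this graph. Adding
  the equations around the cycle with alternating signs eliminates all the unknowns on the left-hand
  side and leaves one relation for each \<open>f\<^sub>i\<close>. Neighbours of a common vertex differ in their first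
  coordinate, so consecutive first coordinates on either side of the cycle are distinct. For length
  six the relations of \<open>f\<^sub>1\<close> and \<open>f\<^sub>2\<close> already contradict this (\<open>hexagon_elimination\<close>); for length
  eight those of \<open>f\<^sub>1, ..., f\<^sub>4\<close> do (\<open>octagon_elimination\<close>).
\<close>

section \<open>Finite fields\<close>

text \<open>
  The polynomial \<open>X\<^sup>q - X\<close> splits into \<open>q\<close> linear factors over an algebraically closed field. Its
  derivative is the constant \<open>-1\<close>, because \<open>q\<close> is divisible by the characteristic, so no factor can
  occur twice.
\<close>

lemma card_frobenius_fixed_points:
  fixes q m :: nat
  assumes "prime CHAR('f::alg_closed_field)" and q: "q = CHAR('f) ^ m" and "m \<ge> 1"
  shows "card {x :: 'f. x ^ q = x} = q"
proof -
  have "q > 1"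
    unfolding q using assms(1,3) by (intro one_less_power) (auto dest: prime_gt_1_nat)
  have q0: "(of_nat q :: 'f) = 0"
    unfolding q using \<open>m \<ge> 1\<close> by (simp add: zero_power)
  define p :: "'f poly" where "p = monom 1 q - [:0, 1:]"
  have poly_p: "poly p x = x ^ q - x" for x
    by (simp add: p_def poly_monom)
  have degree_p: "degree p = q"
    unfolding p_def diff_conv_add_uminus using \<open>q > 1\<close>
    by (subst degree_add_eq_left) (auto simp: degree_monom_eq)
  then have "p \<noteq> 0"
    using \<open>q > 1\<close> by auto
  have pderiv_p: "pderiv p = [:-1:]"
    by (simp add: p_def pderiv_diff pderiv_monom q0 pderiv_pCons one_pCons)
  obtain A where A: "size A = degree p" "p = smult (lead_coeff p) (\<Prod>x\<in>#A. [:-x, 1:])"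
    using alg_closed_imp_factorization[OF \<open>p \<noteq> 0\<close>] by blast
  \<comment> \<open>A double root would also be a root of the derivative.\<close>
  have simple: "count A x \<le> 1" for x
  proof (rule ccontr)
    assume "\<not> count A x \<le> 1"
    then have "replicate_mset 2 x \<subseteq># A"
      by (metis count_le_replicate_mset_subset_eq not_less_eq_eq numeral_2_eq_2 One_nat_def)
    then obtain B where "A = replicate_mset 2 x + B"
      using mset_subset_eq_exists_conv by metis
    then have "p = [:-x, 1:] * ([:-x, 1:] * smult (lead_coeff p) (\<Prod>x\<in>#B. [:-x, 1:]))"
      using A(2) by (simp add: numeral_2_eq_2)
    then obtain r where "p = [:-x, 1:] * ([:-x, 1:] * r)"
      by blast
    then have "poly (pderiv p) x = 0"
      by (simp only: pderiv_mult poly_add poly_mult) simp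
    then show False
      by (simp add: pderiv_p)
  qed
  have "{x. x ^ q = x} = set_mset A"
  proof -
    have "poly p x = 0 \<longleftrightarrow> x \<in># A" for x
      by (subst A(2), use \<open>p \<noteq> 0\<close> in \<open>induction A; auto\<close>)
    then show ?thesis
      by (auto simp: poly_p)
  qed
  moreover have "A = mset_set (set_mset A)"
  proof (rule multiset_eqI)
    show "count A x = count (mset_set (set_mset A)) x" for x
      using simple[of x] count_greater_zero_iff[of A x]
      by (cases "count A x") (auto simp: count_mset_set')
  qed
  ultimately show ?thesis
    using A(1) degree_p by (metis size_mset_set)
qed

text \<open>
  The type constructor for residue rings takes the modulus as the cardinality of an index type; three
  elements give the field with three elements.
\<close>

datatype three = Zero3 | One3 | Two3

lemma UNIV_three: "UNIV = {Zero3, One3, Two3}"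
  using three.exhaust by auto

instance three :: prime_card
proof
  show "prime CARD(three)"
    by (simp add: UNIV_three numeral_3_eq_3[symmetric] del: One_nat_def)
qed

text \<open>
  The fixed points of \<open>x \<mapsto> x ^ 3 ^ m\<close> are closed under addition because raising to a power of the
  characteristic is additive. The finite field appears as a subset of a fixed type, so that one type
  serves all orders.
\<close>

lemma field_of_order_power_3:
  assumes "m \<ge> 1"
  obtains K :: "three mod_ring alg_closure set"
  where "card K = 3 ^ m" "\<And>x y. x \<in> K \<Longrightarrow> y \<in> K \<Longrightarrow> x + y \<in> K"
    "\<And>x y. x \<in> K \<Longrightarrow> y \<in> K \<Longrightarrow> x * y \<in> K" "\<And>x. x \<in> K \<Longrightarrow> - x \<in> K"
proof -
  have c: "CHAR(three mod_ring alg_closure) = 3"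
    by (simp add: UNIV_three)
  define K where "K = {x :: three mod_ring alg_closure. x ^ 3 ^ m = x}"
  have "x + y \<in> K" if "x \<in> K" "y \<in> K" for x y
    using that freshmans_dream'[of "3 ^ m" m x y]
    by (simp add: K_def c del: semiring_char_mod_ring CHAR_alg_closure)
  moreover have "x * y \<in> K" if "x \<in> K" "y \<in> K" for x y
    using that by (auto simp: K_def power_mult_distrib)
  moreover have "- x \<in> K" if "x \<in> K" for x
    using that by (auto simp: K_def)
  moreover have "card K = 3 ^ m"
    unfolding K_def using c assms
      card_frobenius_fixed_points[where ?'f = "three mod_ring alg_closure" and q = "3 ^ m" and m = m]
    by (simp del: semiring_char_mod_ring CHAR_alg_closure)
  ultimately show thesis
    using that by blast
qed

section \<open>Links and copies of hypergraphs\<close>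

lemma isomorphic_trans:
  assumes "isomorphic G H" "isomorphic H L"
  shows "isomorphic G L"
proof -
  from assms obtain f g where "bij_betw f (verts G) (verts H)" "bij_betw g (verts H) (verts L)"
    and e: "hedges H = image f ` hedges G" "hedges L = image g ` hedges H"
    unfolding isomorphic_def by auto
  then have "bij_betw (g \<circ> f) (verts G) (verts L)"
    by (blast intro: bij_betw_trans)
  moreover have "hedges L = image (g \<circ> f) ` hedges G"
    unfolding e by (simp add: image_image image_comp[symmetric])
  ultimately show ?thesis
    unfolding isomorphic_def by blast
qed

lemma isomorphic_sym:
  assumes "isomorphic G H" and wf: "\<And>e. e \<in> hedges G \<Longrightarrow> e \<subseteq> verts G"
  shows "isomorphic H G"
proof -
  from assms obtain f where f: "bij_betw f (verts G) (verts H)"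
    and e: "hedges H = image f ` hedges G"
    unfolding isomorphic_def by auto
  let ?g = "inv_into (verts G) f"
  have "?g ` f ` d = d" if "d \<in> hedges G" for d
    using f wf[OF that] by (simp add: inv_into_image_cancel bij_betw_def)
  then have "hedges G = image ?g ` hedges H"
    unfolding e by (simp add: image_image)
  then show ?thesis
    unfolding isomorphic_def using bij_betw_inv_into[OF f] by blast
qed

lemma link_graph_wf:
  assumes "uniform_hypergraph 3 G" "e \<in> hedges (link_graph x G)"
  shows "e \<subseteq> verts (link_graph x G)"
proof -
  obtain u v where e: "e = {u, v}" "{x, u, v} \<in> hedges G"
    using assms(2) by (auto simp: link_graph_def)
  then have "{x, u, v} \<subseteq> verts G" "card {x, u, v} = 3"
    using assms(1) by (auto simp: uniform_hypergraph_def)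
  moreover from this have "x \<noteq> u" "x \<noteq> v"
    by (auto simp: card_insert_if split: if_splits)
  ultimately show ?thesis
    using e by (simp add: link_graph_def)
qed

text \<open>
  Only the edges through \<open>x\<close> matter for its link, so \<open>f\<close> need not be an isomorphism of hypergraphs.
  Isolated vertices of the link are covered because \<open>f\<close> is a bijection on all vertices.
\<close>

lemma isomorphic_link_graphs:
  assumes bij: "bij_betw f (verts G) (verts H)" and x: "x \<in> verts G"
    and G: "uniform_hypergraph 3 G" and H: "uniform_hypergraph 3 H"
    and edges: "\<And>u v. u \<in> verts G \<Longrightarrow> v \<in> verts G \<Longrightarrow>
      {x, u, v} \<in> hedges G \<longleftrightarrow> {f x, f u, f v} \<in> hedges H"
  shows "isomorphic (link_graph x G) (link_graph (f x) H)"
proof -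
  have "bij_betw f (verts G - {x}) (verts H - {f x})"
    using bij_betw_DiffI[OF bij bij_betw_singletonI] x bij by (auto simp: bij_betw_def)
  moreover have "{{u, v} |u v. {f x, u, v} \<in> hedges H} = image f ` {{u, v} |u v. {x, u, v} \<in> hedges G}"
  proof (intro equalityI subsetI)
    fix e assume "e \<in> {{u, v} |u v. {f x, u, v} \<in> hedges H}"
    then obtain u v where e: "e = {u, v}" "{f x, u, v} \<in> hedges H"
      by blast
    then have "u \<in> f ` verts G" "v \<in> f ` verts G"
      using H bij by (auto simp: uniform_hypergraph_def bij_betw_def)
    then obtain u' v' where "u' \<in> verts G" "v' \<in> verts G" "u = f u'" "v = f v'"
      by blast
    then have "{x, u', v'} \<in> hedges G" "e = f ` {u', v'}"
      using e edges by auto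
    then show "e \<in> image f ` {{u, v} |u v. {x, u, v} \<in> hedges G}"
      by blast
  next
    fix e assume "e \<in> image f ` {{u, v} |u v. {x, u, v} \<in> hedges G}"
    then obtain u v where e: "e = {f u, f v}" "{x, u, v} \<in> hedges G"
      by auto
    then have "u \<in> verts G" "v \<in> verts G"
      using G by (auto simp: uniform_hypergraph_def)
    then show "e \<in> {{u, v} |u v. {f x, u, v} \<in> hedges H}"
      using e edges by blast
  qed
  ultimately show ?thesis
    unfolding isomorphic_def link_graph_def hypergraph.simps by blast
qed

text \<open>
  Freeness follows from the absence of such an injective map, and injective maps compose
  with relabellings more easily than subhypergraphs do.
\<close>

definition embeds :: "'b hypergraph \<Rightarrow> 'a hypergraph \<Rightarrow> bool" where
  "embeds H G \<longleftrightarrow> (\<exists>g. inj_on g (verts H) \<and> g ` verts H \<subseteq> verts G \<and>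
     (\<forall>e\<in>hedges H. g ` e \<in> hedges G))"

lemma is_free_if_not_embeds:
  assumes "\<not> embeds H G"
  shows "is_free H G"
  unfolding is_free_def
proof
  assume "\<exists>S. subhypergraph S G \<and> isomorphic S H"
  then obtain S where S: "subhypergraph S G" "isomorphic S H"
    by blast
  then have "isomorphic H S"
    using isomorphic_sym[OF S(2)] by (auto simp: subhypergraph_def)
  then obtain g where "bij_betw g (verts H) (verts S)" "hedges S = image g ` hedges H"
    unfolding isomorphic_def by auto
  then have "embeds H G"
    unfolding embeds_def using S(1) by (intro exI[of _ g]) (auto simp: subhypergraph_def bij_betw_def)
  then show False
    using assms by blast
qed

text \<open>
  A suspended cycle is a cycle in the link of one vertex \<open>w\<close>, the image of the apex.
\<close>

lemma embeds_suspension_cycleE: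
  assumes "embeds (suspension (cycle_graph n)) G"
  obtains w c where "w \<in> verts G" "inj_on c {..<n}" "c ` {..<n} \<subseteq> verts G"
    "\<And>i. i < n \<Longrightarrow> {w, c i, c ((i + 1) mod n)} \<in> hedges G"
proof -
  obtain g where g: "inj_on g (verts (suspension (cycle_graph n)))"
      "g ` verts (suspension (cycle_graph n)) \<subseteq> verts G"
    and edges: "\<forall>e\<in>hedges (suspension (cycle_graph n)). g ` e \<in> hedges G"
    using assms unfolding embeds_def by auto
  have e: "g ` insert None (Some ` {i, (i + 1) mod n}) \<in> hedges G" if "i < n" for i
  proof (rule bspec[OF edges])
    have "{i, (i + 1) mod n} \<in> hedges (cycle_graph n)"
      using that by (auto simp: cycle_graph_def)
    then show "insert None (Some ` {i, (i + 1) mod n}) \<in> hedges (suspension (cycle_graph n))"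
      unfolding suspension_def hypergraph.simps by (rule imageI)
  qed
  have "verts (suspension (cycle_graph n)) = insert None (Some ` {..<n})"
    by (simp add: suspension_def cycle_graph_def)
  note g = g[unfolded this]
  show thesis
  proof (rule that[of "g None" "g \<circ> Some"])
    show "inj_on (g \<circ> Some) {..<n}"
      using g(1) by (auto simp: inj_on_def)
    show "{g None, (g \<circ> Some) i, (g \<circ> Some) ((i + 1) mod n)} \<in> hedges G" if "i < n" for i
      using e[OF that] by simp
  qed (use g(2) in auto)
qed

text \<open>
  The construction lives on tuples over a finite field. Every property in question survives the
  passage to natural numbers as vertices.
\<close>

lemma copy_on_nat:
  fixes G :: "'a hypergraph"
  assumes fin: "finite (verts G)" and G: "uniform_hypergraph 3 G" "three_partite G"
  obtains H :: "nat hypergraph" where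
    "uniform_hypergraph 3 H" "three_partite H"
    "card (verts H) = card (verts G)" "card (hedges H) = card (hedges G)"
    "(\<And>x y. x \<in> verts G \<Longrightarrow> y \<in> verts G \<Longrightarrow> isomorphic (link_graph x G) (link_graph y G)) \<Longrightarrow>
       (\<forall>x\<in>verts H. \<forall>y\<in>verts H. isomorphic (link_graph x H) (link_graph y H))"
    "\<And>F :: 'b hypergraph. embeds F H \<Longrightarrow> embeds F G"
proof -
  obtain f :: "'a \<Rightarrow> nat" where f: "inj_on f (verts G)"
    using fin finite_imp_inj_to_nat_seg by metis
  have wf: "e \<subseteq> verts G" "card e = 3" if "e \<in> hedges G" for e
    using that G(1) by (auto simp: uniform_hypergraph_def)
  define H where "H = \<lparr>verts = f ` verts G, hedges = image f ` hedges G\<rparr>"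
  have bij: "bij_betw f (verts G) (verts H)"
    using f by (simp add: H_def bij_betw_def)
  have card_image_f: "card (f ` e) = card e" if "e \<subseteq> verts G" for e
    using f that by (meson card_image inj_on_subset)
  have edge_iff: "e \<in> hedges G \<longleftrightarrow> f ` e \<in> hedges H" if "e \<subseteq> verts G" for e
    using wf that f by (auto simp: H_def inj_on_image_eq_iff)
  have H: "uniform_hypergraph 3 H"
    using wf card_image_f by (auto simp: uniform_hypergraph_def H_def)
  moreover have "three_partite H"
  proof -
    obtain A B C where p: "A \<union> B \<union> C = verts G" "A \<inter> B = {}" "A \<inter> C = {}" "B \<inter> C = {}"
      and e: "\<forall>e\<in>hedges G. card (e \<inter> A) = 1 \<and> card (e \<inter> B) = 1 \<and> card (e \<inter> C) = 1"
      using G(2) unfolding three_partite_def by blast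
    have int: "f ` U \<inter> f ` V = f ` (U \<inter> V)" if "U \<subseteq> verts G" "V \<subseteq> verts G" for U V
      using inj_on_image_Int[OF f that] by simp
    have sub: "A \<subseteq> verts G" "B \<subseteq> verts G" "C \<subseteq> verts G"
      using p(1) by auto
    have c: "card (f ` d \<inter> f ` U) = card (d \<inter> U)" if "d \<in> hedges G" "U \<subseteq> verts G" for d U
      using int[OF wf(1)[OF that(1)] that(2)] card_image_f[of "d \<inter> U"] that by auto
    have "f ` A \<union> f ` B \<union> f ` C = verts H"
      using p(1) by (auto simp: H_def)
    moreover have "f ` A \<inter> f ` B = {}" "f ` A \<inter> f ` C = {}" "f ` B \<inter> f ` C = {}"
      using int sub p(2-4) by auto
    moreover have "\<forall>e\<in>hedges H. card (e \<inter> f ` A) = 1 \<and> card (e \<inter> f ` B) = 1 \<and> card (e \<inter> f ` C) = 1"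
      using e c sub by (auto simp: H_def)
    ultimately show ?thesis
      unfolding three_partite_def by blast
  qed
  moreover have "card (verts H) = card (verts G)"
    using bij by (simp add: bij_betw_same_card)
  moreover have "card (hedges H) = card (hedges G)"
    unfolding H_def hypergraph.simps
    by (rule card_image) (meson f inj_on_def inj_on_image_eq_iff wf(1))
  moreover have "\<forall>x\<in>verts H. \<forall>y\<in>verts H. isomorphic (link_graph x H) (link_graph y H)"
    if links: "\<And>x y. x \<in> verts G \<Longrightarrow> y \<in> verts G \<Longrightarrow> isomorphic (link_graph x G) (link_graph y G)"
  proof -
    have copy: "isomorphic (link_graph x G) (link_graph (f x) H)" if "x \<in> verts G" for x
      using edge_iff[of "{x, _, _}"] that
      by (intro isomorphic_link_graphs[OF bij _ G(1) H]) auto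
    have "isomorphic (link_graph (f x) H) (link_graph (f y) H)"
      if "x \<in> verts G" "y \<in> verts G" for x y
      using isomorphic_sym[OF copy link_graph_wf[OF G(1)]] links copy that
      by (meson isomorphic_trans)
    then show ?thesis
      by (auto simp: H_def)
  qed
  moreover have "embeds F G" if F: "embeds F H" for F :: "'b hypergraph"
  proof -
    obtain g where g: "inj_on g (verts F)" "g ` verts F \<subseteq> verts H"
        "\<And>e. e \<in> hedges F \<Longrightarrow> g ` e \<in> hedges H"
      using F by (auto simp: embeds_def)
    let ?h = "inv_into (verts G) f"
    have h: "bij_betw ?h (verts H) (verts G)"
      by (rule bij_betw_inv_into[OF bij])
    have "inj_on (?h \<circ> g) (verts F)"
      using g(1,2) h by (meson bij_betw_def comp_inj_on inj_on_subset)
    moreover have "(?h \<circ> g) ` verts F \<subseteq> verts G"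
      using g(2) h by (auto simp: bij_betw_def)
    moreover have "(?h \<circ> g) ` e \<in> hedges G" if e: "e \<in> hedges F" for e
    proof -
      obtain d where d: "d \<in> hedges G" "g ` e = f ` d"
        using g(3)[OF e] by (auto simp: H_def)
      then have "(?h \<circ> g) ` e = ?h ` f ` d"
        by (metis image_comp)
      also have "\<dots> = d"
        using f wf(1)[OF d(1)] by (simp add: inv_into_image_cancel)
      finally have "(?h \<circ> g) ` e = d" .
      then show ?thesis
        using d by simp
    qed
    ultimately show ?thesis
      unfolding embeds_def by blast
  qed
  ultimately show thesis
    by (rule that)
qed

section \<open>Relations around a hexagon and an octagon\<close>

text \<open>
  Here \<open>a1, b1, a2, b2, a3, b3\<close> are the first coordinates around a closed walk of length six. Subtracting
  the first relation \<open>a2 + a3\<close> times from the second leaves a product of three differences.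
\<close>

lemma hexagon_elimination:
  fixes a1 a2 a3 b1 b2 b3 :: "'f::field"
  assumes distinct: "a1 \<noteq> a2" "a3 \<noteq> a1" "b3 \<noteq> b1"
    and xy: "(a1 - a2) * b1 + (a2 - a3) * b2 + (a3 - a1) * b3 = 0"
    and xxy: "(a1^2 - a2^2) * b1 + (a2^2 - a3^2) * b2 + (a3^2 - a1^2) * b3 = 0"
  shows False
proof -
  have "(a1 - a3) * (b1 - b3) * (a1 - a2) =
    ((a1^2 - a2^2) * b1 + (a2^2 - a3^2) * b2 + (a3^2 - a1^2) * b3)
    - (a2 + a3) * ((a1 - a2) * b1 + (a2 - a3) * b2 + (a3 - a1) * b3)"
    by (simp add: algebra_simps power2_eq_square)
  then show False
    using distinct by (simp add: xy xxy)
qed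

text \<open>
  The relations of a closed walk of length eight after translating the first coordinates so that
  \<open>a1 = 0\<close> and \<open>b4 = 0\<close>; then \<open>p, r, s\<close> stand for \<open>a2, a3, a4\<close> and \<open>u, v, w\<close> for \<open>b1, b2, b3\<close>.
  With \<open>A1 = 0\<close>, the second coordinates are \<open>A2 = u * p\<close>, \<open>A3 = w * (r - s)\<close> and \<open>A4 = 0\<close>.

  The relations \<open>xy\<close> and \<open>xxy\<close> say that the vector with entries \<open>p * (u - v)\<close> and \<open>r * (v - w)\<close> is
  orthogonal to \<open>(p - s, r - s)\<close>, and \<open>xyA\<close> says that it is orthogonal to \<open>(A2, A3)\<close>. As this
  vector is nonzero, \<open>(A2, A3)\<close> is a multiple of \<open>(p - s, r - s)\<close>, and the factor is \<open>w\<close> because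
  \<open>A3 = w * (r - s)\<close>. Feeding \<open>A2 = w * (p - s)\<close> into \<open>xyy\<close> produces one more relation, which
  forces \<open>p = s\<close>, and then \<open>A2 = 0\<close>.
\<close>

lemma octagon_elimination_normalised:
  fixes p r s u v w :: "'f::field"
  assumes distinct: "p \<noteq> 0" "p \<noteq> r" "r \<noteq> s" "u \<noteq> 0" "u \<noteq> v" "w \<noteq> 0"
    and xy: "p * (u - v) + r * (v - w) + s * w = 0"
    and xxy: "p^2 * (u - v) + r^2 * (v - w) + s^2 * w = 0"
    and xyy: "u^2 * p + v^2 * (r - p) + w^2 * (s - r) = 0"
    and xyA: "(u - v) * p * (u * p) + (v - w) * r * (w * (r - s)) = 0"
  shows False
proof -
  have e: "p * (u - v) * (p - s) + r * (v - w) * (r - s) = 0"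
  proof -
    have "p * (u - v) * (p - s) + r * (v - w) * (r - s) =
      (p^2 * (u - v) + r^2 * (v - w) + s^2 * w) - s * (p * (u - v) + r * (v - w) + s * w)"
      by (simp add: algebra_simps power2_eq_square)
    then show ?thesis by (simp add: xy xxy)
  qed
  have "(u - v) * p * (r - s) * (u * p - w * (p - s)) =
    (r - s) * ((u - v) * p * (u * p) + (v - w) * r * (w * (r - s)))
    - w * (r - s) * (p * (u - v) * (p - s) + r * (v - w) * (r - s))"
    by (simp add: algebra_simps power2_eq_square)
  then have A2: "u * p = w * (p - s)"
    using distinct by (simp add: xyA e)
  have "w * ((p - s) * (u - v) + (r - s) * (v - w)) = 0"
    using xyy xy A2 by Groebner_Basis.algebra
  then have f: "(p - s) * (u - v) + (r - s) * (v - w) = 0"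
    using distinct by simp
  have "(u - v) * (p - s) * (p - r) =
    (p * (u - v) * (p - s) + r * (v - w) * (r - s)) - r * ((p - s) * (u - v) + (r - s) * (v - w))"
    by (simp add: algebra_simps power2_eq_square)
  then have "p = s"
    using distinct by (simp add: e f)
  then show False
    using A2 distinct by simp
qed

text \<open>
  The translation to \<open>a1 = b4 = 0\<close> changes each of the four sums only by multiples of the earlier ones.
\<close>

lemma octagon_elimination:
  fixes a1 a2 a3 a4 b1 b2 b3 b4 A1 A2 A3 A4 :: "'f::field"
  assumes distinct: "a1 \<noteq> a2" "a2 \<noteq> a3" "a3 \<noteq> a4" "b1 \<noteq> b2" "b3 \<noteq> b4" "b4 \<noteq> b1"
    and A: "A1 - A2 = (a1 - a2) * b1" "A2 - A3 = (a2 - a3) * b2"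
      "A3 - A4 = (a3 - a4) * b3" "A4 - A1 = (a4 - a1) * b4"
    and xxy: "(a1^2 - a2^2) * b1 + (a2^2 - a3^2) * b2 + (a3^2 - a4^2) * b3 + (a4^2 - a1^2) * b4 = 0"
    and xyy: "(a1 - a2) * b1^2 + (a2 - a3) * b2^2 + (a3 - a4) * b3^2 + (a4 - a1) * b4^2 = 0"
    and xyA: "(a1 * b1 * A1 - a2 * b1 * A2) + (a2 * b2 * A2 - a3 * b2 * A3)
      + (a3 * b3 * A3 - a4 * b3 * A4) + (a4 * b4 * A4 - a1 * b4 * A1) = 0"
  shows False
proof -
  define p r s where "p = a2 - a1" and "r = a3 - a1" and "s = a4 - a1"
  define u v w where "u = b1 - b4" and "v = b2 - b4" and "w = b3 - b4"
  have a: "a2 = a1 + p" "a3 = a1 + r" "a4 = a1 + s" and b: "b1 = b4 + u" "b2 = b4 + v" "b3 = b4 + w"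
    by (simp_all add: p_def r_def s_def u_def v_def w_def)
  have xy: "p * (u - v) + r * (v - w) + s * w = 0"
    using A unfolding a b by Groebner_Basis.algebra
  moreover have "p^2 * (u - v) + r^2 * (v - w) + s^2 * w = 0"
    using xxy xy unfolding a b by Groebner_Basis.algebra
  moreover have "u^2 * p + v^2 * (r - p) + w^2 * (s - r) = 0"
    using xyy xy unfolding a b by Groebner_Basis.algebra
  moreover have "(u - v) * p * (u * p) + (v - w) * r * (w * (r - s)) = 0"
    using xyA xy calculation(2,3) A unfolding a b by Groebner_Basis.algebra
  ultimately show False
    using distinct by (intro octagon_elimination_normalised[of p r s u v w])
      (auto simp: p_def r_def s_def u_def v_def w_def)
qed

section \<open>The hypergraph and its links\<close>

text \<open>
  Coordinates are numbered from \<open>0\<close>. The exponents are chosen so that in a link, where the third point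
  is fixed, \<open>form 1\<close> to \<open>form 4\<close> become the defining functions \<open>xy\<close>, \<open>x\<^sup>2y\<close>, \<open>xy\<^sup>2\<close> and \<open>xy x\<^sub>1\<close> of the
  bipartite graphs \<open>D(k,q)\<close> of Lazebnik and Ustimenko for \<open>k \<le> 5\<close>, up to a change of coordinates.
\<close>

definition form :: "nat \<Rightarrow> (nat \<Rightarrow> 'f::field) \<Rightarrow> (nat \<Rightarrow> 'f) \<Rightarrow> 'f" where
  "form i x y =
     (if i = 1 then x 0 * y 0
      else if i = 2 then (x 0)^2 * y 0
      else if i = 3 then x 0 * (y 0)^2
      else if i = 4 then x 0 * y 0 * x 1
      else 0)"

locale coordinate_field =
  fixes K :: "'f::field set" and k :: nat
  assumes fin: "finite K" and nonempty: "K \<noteq> {}"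
    and add: "x \<in> K \<Longrightarrow> y \<in> K \<Longrightarrow> x + y \<in> K"
    and mult: "x \<in> K \<Longrightarrow> y \<in> K \<Longrightarrow> x * y \<in> K"
    and neg: "x \<in> K \<Longrightarrow> - x \<in> K"
    and k: "k \<ge> 2"
begin

lemma zero: "0 \<in> K"
  using nonempty add neg by (metis add.right_inverse ex_in_conv)

lemma diff: "x \<in> K \<Longrightarrow> y \<in> K \<Longrightarrow> x - y \<in> K"
  using add[of x "- y"] neg by simp

definition points :: "(nat \<Rightarrow> 'f) set" where
  "points = {..<k} \<rightarrow>\<^sub>E K"

text \<open>
  The right-hand side is the sum over the three cyclically consecutive pairs, which makes the relation
  invariant under rotation. Symmetrising also within each pair would merge \<open>x\<^sup>2y\<close> and \<open>xy\<^sup>2\<close> into their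
  sum, and the bipartite graph defined by \<open>xy\<close> and \<open>x\<^sup>2y + xy\<^sup>2\<close> contains hexagons.
\<close>

definition incident :: "(nat \<Rightarrow> 'f) \<Rightarrow> (nat \<Rightarrow> 'f) \<Rightarrow> (nat \<Rightarrow> 'f) \<Rightarrow> bool" where
  "incident x y z \<longleftrightarrow>
     (\<forall>i\<in>{1..<k}. x i + y i + z i = form i x y + form i y z + form i z x)"

definition D3 :: "(nat \<times> (nat \<Rightarrow> 'f)) hypergraph" where
  "D3 = \<lparr>verts = {..<3} \<times> points,
     hedges = {{(0, x), (1, y), (2, z)} | x y z.
       x \<in> points \<and> y \<in> points \<and> z \<in> points \<and> incident x y z}\<rparr>"

lemma finite_points: "finite points"
  unfolding points_def using fin by (intro finite_PiE) auto

lemma card_points: "card points = card K ^ k"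
  by (simp add: points_def card_PiE)

lemma points_mem: "x \<in> points \<Longrightarrow> i < k \<Longrightarrow> x i \<in> K"
  by (auto simp: points_def)

lemma points_eqI:
  assumes "x \<in> points" "y \<in> points" "\<And>i. i < k \<Longrightarrow> x i = y i"
  shows "x = y"
  using assms unfolding points_def by (auto intro: PiE_ext)

lemma restrict_in_points: "(\<And>i. i < k \<Longrightarrow> f i \<in> K) \<Longrightarrow> restrict f {..<k} \<in> points"
  by (auto simp: points_def)

lemma form_in_K: "x \<in> points \<Longrightarrow> y \<in> points \<Longrightarrow> form i x y \<in> K"
  using k points_mem[of x] points_mem[of y] by (simp add: form_def power2_eq_square zero mult)

lemma incident_rotate: "incident x y z \<longleftrightarrow> incident y z x"
  unfolding incident_def by (simp add: ac_simps)

lemma finite_verts: "finite (verts D3)"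
  by (simp add: D3_def finite_points)

lemma card_verts: "card (verts D3) = 3 * card K ^ k"
  by (simp add: D3_def card_cartesian_product card_points)

lemma triple_eq_iff:
  "{(0::nat, x), (1, y), (2, z)} = {(0, x'), (1, y'), (2, z')} \<longleftrightarrow> x = x' \<and> y = y' \<and> z = z'"
  by (auto simp: insert_eq_iff doubleton_eq_iff)

lemma uniform: "uniform_hypergraph 3 D3"
  by (auto simp: uniform_hypergraph_def D3_def)

lemma tripartite: "three_partite D3"
  unfolding three_partite_def
proof (intro exI conjI)
  show "{0} \<times> points \<union> {1} \<times> points \<union> {2} \<times> points = verts D3"
    by (auto simp: D3_def)
  have "{(0::nat, x), (1, y), (2, z)} \<inter> {0} \<times> points = {(0, x)}"
    "{(0::nat, x), (1, y), (2, z)} \<inter> {1} \<times> points = {(1, y)}"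
    "{(0::nat, x), (1, y), (2, z)} \<inter> {2} \<times> points = {(2, z)}"
    if "x \<in> points" "y \<in> points" "z \<in> points" for x y z
    using that by auto
  then show "\<forall>e\<in>hedges D3. card (e \<inter> {0} \<times> points) = 1 \<and> card (e \<inter> {1} \<times> points) = 1
      \<and> card (e \<inter> {2} \<times> points) = 1"
    by (auto simp: D3_def simp del: Int_insert_left)
qed auto

text \<open>
  Given two points and the first coordinate of the third, the other coordinates are determined one at
  a time: \<open>form 1\<close> sees only first coordinates, and the higher forms see only the first two.
\<close>

lemma completion_in_points:
  assumes "x \<in> points" "y \<in> points" "t \<in> K"
  shows "\<exists>z\<in>points. incident x y z \<and> z 0 = t"
proof -
  \<comment> \<open>The auxiliary \<open>w\<close> has the right coordinates \<open>0\<close> and \<open>1\<close>, which are all that the forms read.\<close>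
  define w where
    "w = restrict (\<lambda>i. if i = 0 then t else x 0 * y 0 + y 0 * t + t * x 0 - x 1 - y 1) {..<k}"
  define z where
    "z = restrict (\<lambda>i. if i = 0 then t
       else form i x y + form i y w + form i w x - x i - y i) {..<k}"
  have w: "w \<in> points"
    unfolding w_def using assms(3) points_mem[OF assms(1)] points_mem[OF assms(2)] k
    by (intro restrict_in_points) (simp add: add mult diff)
  have "z \<in> points"
    unfolding z_def using assms(3) points_mem[OF assms(1)] points_mem[OF assms(2)]
      form_in_K[OF assms(1,2)] form_in_K[OF assms(2) w] form_in_K[OF w assms(1)]
    by (intro restrict_in_points) (simp add: add diff)
  moreover have agree: "z 0 = t" "w 0 = t" "z 1 = w 1"
    using k by (auto simp: z_def w_def form_def)
  moreover have "incident x y z"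
  proof -
    have "form i y z = form i y w" "form i z x = form i w x" for i
      using agree by (auto simp: form_def)
    then show ?thesis
      by (auto simp: incident_def z_def)
  qed
  ultimately show ?thesis
    by blast
qed

lemma completion_unique:
  assumes "z \<in> points" "z' \<in> points" "incident x y z" "incident x y z'" "z 0 = z' 0"
  shows "z = z'"
proof (rule points_eqI[OF assms(1,2)])
  have eq: "z i = z' i" if "form i y z = form i y z'" "form i z x = form i z' x" "i \<in> {1..<k}" for i
    using assms(3,4) that unfolding incident_def by (metis add_left_cancel)
  have "z 1 = z' 1"
    using assms(5) k by (intro eq) (auto simp: form_def)
  then show "z i = z' i" if "i < k" for i
    using eq[of i] assms(5) that by (cases "i = 0") (auto simp: form_def)
qed

text \<open>
  An edge is determined by \<open>x\<close>, \<open>y\<close> and the first coordinate of \<open>z\<close>, which can be chosen freely.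
\<close>

lemma card_edges: "card (hedges D3) = card K ^ (2 * k + 1)"
proof -
  let ?T = "{(x, y, z). x \<in> points \<and> y \<in> points \<and> z \<in> points \<and> incident x y z}"
  have "hedges D3 = (\<lambda>(x, y, z). {(0, x), (1, y), (2, z)}) ` ?T"
    by (auto simp: D3_def image_iff)
  moreover have "inj_on (\<lambda>(x, y, z). {(0::nat, x), (1, y), (2, z)}) ?T"
  proof (rule inj_onI)
    fix p p' :: "(nat \<Rightarrow> 'f) \<times> (nat \<Rightarrow> 'f) \<times> (nat \<Rightarrow> 'f)"
    assume "(case p of (x, y, z) \<Rightarrow> {(0::nat, x), (1, y), (2, z)}) =
      (case p' of (x, y, z) \<Rightarrow> {(0, x), (1, y), (2, z)})"
    then show "p = p'"
      by (cases p; cases p') (simp only: prod.case triple_eq_iff)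
  qed
  moreover have "bij_betw (\<lambda>(x, y, z). (x, y, z 0)) ?T (points \<times> points \<times> K)"
    unfolding bij_betw_def
  proof (intro conjI equalityI subsetI)
    show "inj_on (\<lambda>(x, y, z). (x, y, z 0)) ?T"
      using completion_unique by (auto simp: inj_on_def)
  next
    fix p assume "p \<in> points \<times> points \<times> K"
    then obtain x y t where p: "p = (x, y, t)" "x \<in> points" "y \<in> points" "t \<in> K"
      by auto
    then obtain z where "z \<in> points" "incident x y z" "z 0 = t"
      using completion_in_points by blast
    then show "p \<in> (\<lambda>(x, y, z). (x, y, z 0)) ` ?T"
      using p by (intro image_eqI[of _ _ "(x, y, z)"]) auto
  qed (use k in \<open>auto intro: points_mem\<close>)
  ultimately have "card (hedges D3) = card (points \<times> points \<times> K)"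
    by (simp add: card_image bij_betw_same_card)
  then show ?thesis
    by (simp add: card_cartesian_product card_points power_add mult_2)
qed

lemma edge_at_apex:
  assumes "z \<in> points" "a \<in> points" "b \<in> points"
  shows "{(2, z), (j, a), (l, b)} \<in> hedges D3 \<longleftrightarrow>
    (j = 0 \<and> l = 1 \<and> incident a b z) \<or> (j = 1 \<and> l = 0 \<and> incident b a z)"
proof
  assume "{(2, z), (j, a), (l, b)} \<in> hedges D3"
  then obtain x y z' where e: "{(2, z), (j, a), (l, b)} = {(0, x), (1, y), (2, z')}" "incident x y z'"
    by (auto simp: D3_def)
  have "(2, z) \<in> {(0::nat, x), (1, y), (2, z')}" "(j, a) \<in> {(0, x), (1, y), (2, z')}"
    "(l, b) \<in> {(0, x), (1, y), (2, z')}"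
    unfolding e(1)[symmetric] by simp_all
  moreover have "(0, x) \<in> {(2, z), (j, a), (l, b)}" "(1, y) \<in> {(2, z), (j, a), (l, b)}"
    unfolding e(1) by simp_all
  ultimately show "(j = 0 \<and> l = 1 \<and> incident a b z) \<or> (j = 1 \<and> l = 0 \<and> incident b a z)"
    using e(2) by auto
next
  have sets: "{(2, z), (0, a), (1, b)} = {(0, a), (1, b), (2::nat, z)}"
    "{(2, z), (1, a), (0, b)} = {(0, b), (1, a), (2::nat, z)}"
    by auto
  assume "(j = 0 \<and> l = 1 \<and> incident a b z) \<or> (j = 1 \<and> l = 0 \<and> incident b a z)"
  then show "{(2, z), (j, a), (l, b)} \<in> hedges D3"
    using assms sets unfolding D3_def hypergraph.simps by blast
qed

definition origin :: "nat \<Rightarrow> 'f" where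
  "origin = restrict (\<lambda>_. 0) {..<k}"

lemma origin_in_points: "origin \<in> points"
  unfolding origin_def using zero by (intro restrict_in_points)

lemma incident_origin:
  "incident x y origin \<longleftrightarrow> (\<forall>i\<in>{1..<k}. x i + y i = form i x y)"
proof -
  have "form i y origin = 0" "form i origin x = 0" for i
    using k by (auto simp: form_def origin_def)
  then show ?thesis
    by (auto simp: incident_def origin_def)
qed

text \<open>
  For a fixed third point \<open>z\<close>, every term of the incidence relation that depends on \<open>x\<close> alone or on \<open>y\<close>
  alone can be absorbed into the coordinates of \<open>x\<close> or \<open>y\<close>. This leaves \<open>form i x y\<close>, but for \<open>i = 4\<close>
  it is expressed in the old coordinate \<open>x 1\<close>. Replacing that by the new one changes \<open>form 4\<close> by
  \<open>z 1 * form 1 x y - z 0 * form 2 x y\<close>, and the extra summand at \<open>i = 4\<close> compensates this with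
  multiples of the equations for \<open>i = 1\<close> and \<open>i = 2\<close>.
\<close>

definition shear_first :: "(nat \<Rightarrow> 'f) \<Rightarrow> (nat \<Rightarrow> 'f) \<Rightarrow> (nat \<Rightarrow> 'f)" where
  "shear_first z x = restrict (\<lambda>i. if i = 0 then x 0 else x i + z i - form i z x +
     (if i = 4 then z 1 * (x 1 + z 1 - form 1 z x) - z 0 * (x 2 + z 2 - form 2 z x) else 0)) {..<k}"

definition shear_second :: "(nat \<Rightarrow> 'f) \<Rightarrow> (nat \<Rightarrow> 'f) \<Rightarrow> (nat \<Rightarrow> 'f)" where
  "shear_second z y = restrict (\<lambda>i. if i = 0 then y 0 else y i - form i y z +
     (if i = 4 then z 1 * (y 1 - form 1 y z) - z 0 * (y 2 - form 2 y z) else 0)) {..<k}"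

lemma shear_in_points:
  assumes "z \<in> points" "x \<in> points"
  shows "shear_first z x \<in> points" "shear_second z x \<in> points"
  unfolding shear_first_def shear_second_def
  using points_mem[OF assms(1)] points_mem[OF assms(2)] form_in_K[OF assms] form_in_K[OF assms(2,1)] k
  by (intro restrict_in_points; simp add: add mult diff zero)+

lemma shear_first_inj:
  assumes "z \<in> points" shows "inj_on (shear_first z) points"
proof (rule inj_onI)
  fix x x' assume x: "x \<in> points" "x' \<in> points" and eq: "shear_first z x = shear_first z x'"
  have c: "shear_first z x i = shear_first z x' i" for i
    by (simp add: eq)
  have c0: "x 0 = x' 0"
    using c[of 0] k by (simp add: shear_first_def)
  have form_eq: "form i z x = form i z x'" for i
    by (simp add: form_def c0)
  have low: "x i = x' i" if "i < k" "i \<noteq> 4" for i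
    using c[of i] that c0 by (cases "i = 0") (simp_all add: shear_first_def form_eq)
  have "x 4 = x' 4" if "4 < k"
    using c[of 4] that low[of 1] low[of 2] by (simp add: shear_first_def form_eq)
  then show "x = x'"
    using low by (intro points_eqI[OF x]) blast
qed

lemma shear_second_inj:
  assumes "z \<in> points" shows "inj_on (shear_second z) points"
proof (rule inj_onI)
  fix x x' assume x: "x \<in> points" "x' \<in> points" and eq: "shear_second z x = shear_second z x'"
  have c: "shear_second z x i = shear_second z x' i" for i
    by (simp add: eq)
  have c0: "x 0 = x' 0"
    using c[of 0] k by (simp add: shear_second_def)
  have form_eq: "form i x z = form i x' z" if "i \<noteq> 4" for i
    using that by (simp add: form_def c0)
  have low: "x i = x' i" if "i < k" "i \<noteq> 4" for i
    using c[of i] that c0 by (cases "i = 0") (simp_all add: shear_second_def form_eq)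
  have "form 4 x z = form 4 x' z"
    using low[of 1] c0 k by (simp add: form_def)
  then have "x 4 = x' 4" if "4 < k"
    using c[of 4] that low[of 1] low[of 2] form_eq by (simp add: shear_second_def)
  then show "x = x'"
    using low by (intro points_eqI[OF x]) blast
qed

text \<open>
  The equations for the index \<open>4\<close> agree only modulo those for \<open>1\<close> and \<open>2\<close>, so the two systems are
  equivalent as a whole although not equation by equation.
\<close>

lemma incident_shear:
  "incident x y z \<longleftrightarrow> incident (shear_first z x) (shear_second z y) origin"
proof -
  let ?x = "shear_first z x" and ?y = "shear_second z y"
  let ?I = "\<lambda>i. x i + y i + z i = form i x y + form i y z + form i z x"
  let ?J = "\<lambda>i. ?x i + ?y i = form i ?x ?y"
  have low: "?I i \<longleftrightarrow> ?J i" if "i \<in> {1..<k}" "i \<noteq> 4" for i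
    using that by (auto simp: form_def shear_first_def shear_second_def algebra_simps)
  have "?I 4 \<longleftrightarrow> ?J 4" if "4 < k" "?I 1" "?I 2"
    using that unfolding form_def shear_first_def shear_second_def by simp Groebner_Basis.algebra
  then have "?I i \<longleftrightarrow> ?J i" if "i \<in> {1..<k}" "\<forall>i\<in>{1..<4}. i < k \<longrightarrow> ?I i" for i
    using low that by (cases "i = 4") auto
  then show ?thesis
    unfolding incident_def[of x y z] incident_origin using low by auto
qed

text \<open>
  The translation on the third part sends \<open>z\<close> to the origin and permutes the points that are isolated in
  the link.
\<close>

definition straighten :: "(nat \<Rightarrow> 'f) \<Rightarrow> nat \<times> (nat \<Rightarrow> 'f) \<Rightarrow> nat \<times> (nat \<Rightarrow> 'f)" where
  "straighten z = (\<lambda>(j, v). (j, if j = 0 then shear_first z v else if j = 1 then shear_second z v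
     else restrict (\<lambda>i. v i - z i) {..<k}))"

lemma straighten_bij:
  assumes z: "z \<in> points"
  shows "bij_betw (straighten z) (verts D3) (verts D3)"
proof -
  have t: "restrict (\<lambda>i. v i - z i) {..<k} \<in> points" if "v \<in> points" for v
    using z that by (intro restrict_in_points diff points_mem)
  have t_inj: "v = w" if "v \<in> points" "w \<in> points"
    "restrict (\<lambda>i. v i - z i) {..<k} = restrict (\<lambda>i. w i - z i) {..<k}" for v w
  proof (rule points_eqI[OF that(1,2)])
    show "v i = w i" if "i < k" for i
      using fun_cong[OF \<open>restrict (\<lambda>i. v i - z i) {..<k} = _\<close>, of i] that by simp
  qed
  have "inj_on (straighten z) (verts D3)"
    using shear_first_inj[OF z] shear_second_inj[OF z] t_inj
    by (auto simp: inj_on_def straighten_def D3_def split: if_splits)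
  moreover have "straighten z ` verts D3 \<subseteq> verts D3"
    using shear_in_points[OF z] t by (auto simp: straighten_def D3_def)
  ultimately show ?thesis
    using endo_inj_surj[OF finite_verts] by (auto simp: bij_betw_def)
qed

lemma straighten_apex:
  assumes "z \<in> points" shows "straighten z (2, z) = (2, origin)"
  by (auto simp: straighten_def origin_def)

lemma straighten_edge:
  assumes z: "z \<in> points" and "u \<in> verts D3" "v \<in> verts D3"
  shows "{(2, z), u, v} \<in> hedges D3 \<longleftrightarrow> {straighten z (2, z), straighten z u, straighten z v} \<in> hedges D3"
proof -
  obtain j a l b where uv: "u = (j, a)" "v = (l, b)" "a \<in> points" "b \<in> points"
    using assms by (auto simp: D3_def)
  have "straighten z u \<in> verts D3" "straighten z v \<in> verts D3"
    using straighten_bij[OF z] assms by (auto simp: bij_betw_def)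
  then obtain j' a' l' b' where uv': "straighten z u = (j', a')" "straighten z v = (l', b')"
    "a' \<in> points" "b' \<in> points"
    by (auto simp: D3_def)
  then have "j' = j" "l' = l"
    and "j = 0 \<Longrightarrow> a' = shear_first z a" "j = 1 \<Longrightarrow> a' = shear_second z a"
    and "l = 0 \<Longrightarrow> b' = shear_first z b" "l = 1 \<Longrightarrow> b' = shear_second z b"
    by (auto simp: uv straighten_def)
  then show ?thesis
    unfolding straighten_apex[OF z] uv' unfolding uv edge_at_apex[OF z uv(3,4)]
      edge_at_apex[OF origin_in_points uv'(3,4)]
    using incident_shear[of a b z] incident_shear[of b a z] by auto
qed

definition rotation :: "nat \<times> (nat \<Rightarrow> 'f) \<Rightarrow> nat \<times> (nat \<Rightarrow> 'f)" where
  "rotation = (\<lambda>(j, v). ((j + 1) mod 3, v))"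

lemma rotation_cubed: "v \<in> verts D3 \<Longrightarrow> rotation (rotation (rotation v)) = v"
  by (auto simp: rotation_def D3_def mod_Suc)

lemma rotation_verts: "v \<in> verts D3 \<Longrightarrow> rotation v \<in> verts D3"
  by (auto simp: rotation_def D3_def)

lemma rotation_bij: "bij_betw rotation (verts D3) (verts D3)"
  by (rule bij_betw_byWitness[where f' = "rotation \<circ> rotation"])
    (auto simp: rotation_cubed rotation_verts)

lemma rotation_edge:
  assumes "e \<in> hedges D3" shows "rotation ` e \<in> hedges D3"
proof -
  obtain x y z where e: "e = {(0, x), (1, y), (2, z)}" "x \<in> points" "y \<in> points" "z \<in> points"
      "incident x y z"
    using assms by (auto simp: D3_def)
  have "rotation ` e = {(0, z), (1, x), (2, y)}"
    unfolding e(1) by (simp add: rotation_def insert_commute numeral_2_eq_2)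
  moreover have "incident z x y"
    using e(5) incident_rotate[of z x y] by simp
  ultimately show ?thesis
    using e(2-4) unfolding D3_def hypergraph.simps by blast
qed

lemma rotation_edge_iff:
  assumes "e \<subseteq> verts D3" shows "rotation ` e \<in> hedges D3 \<longleftrightarrow> e \<in> hedges D3"
proof -
  have "rotation ` rotation ` rotation ` e = e"
    using assms rotation_cubed by (force simp: image_image)
  then show ?thesis
    using rotation_edge by metis
qed

text \<open>
  Rotations move \<open>w\<close> into the third part, and straightening then moves it to the origin. All links are
  therefore copies of a single one.
\<close>

lemma link_straightening:
  assumes w: "w \<in> verts D3"
  obtains f where "bij_betw f (verts D3) (verts D3)" "f w = (2, origin)"
    "\<And>u v. u \<in> verts D3 \<Longrightarrow> v \<in> verts D3 \<Longrightarrow>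
      {w, u, v} \<in> hedges D3 \<longleftrightarrow> {(2, origin), f u, f v} \<in> hedges D3"
proof -
  note result = that
  have *: thesis if \<rho>: "bij_betw \<rho> (verts D3) (verts D3)" and w2: "\<rho> w = (2, z)"
    and e: "\<And>e. e \<subseteq> verts D3 \<Longrightarrow> \<rho> ` e \<in> hedges D3 \<longleftrightarrow> e \<in> hedges D3" for \<rho> z
  proof -
    have \<rho>_mem: "\<rho> v \<in> verts D3" if "v \<in> verts D3" for v
      using \<rho> that by (auto simp: bij_betw_def)
    have z: "z \<in> points"
      using \<rho>_mem[OF w] w2 by (auto simp: D3_def)
    show thesis
    proof (rule result[of "straighten z \<circ> \<rho>"])
      show "bij_betw (straighten z \<circ> \<rho>) (verts D3) (verts D3)"
        using \<rho> straighten_bij[OF z] by (rule bij_betw_trans)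
      show "(straighten z \<circ> \<rho>) w = (2, origin)"
        by (simp add: w2 straighten_apex[OF z])
      show "{w, u, v} \<in> hedges D3 \<longleftrightarrow>
          {(2, origin), (straighten z \<circ> \<rho>) u, (straighten z \<circ> \<rho>) v} \<in> hedges D3"
        if "u \<in> verts D3" "v \<in> verts D3" for u v
        using e[of "{w, u, v}"] straighten_edge[OF z \<rho>_mem[OF that(1)] \<rho>_mem[OF that(2)]] that w
        by (simp add: w2 straighten_apex[OF z])
    qed
  qed
  obtain j z where wj: "w = (j, z)" "j < 3"
    using w by (auto simp: D3_def)
  then consider "j = 2" | "j = 1" | "j = 0"
    by linarith
  then show thesis
  proof cases
    case 1
    show thesis
      by (rule *[of id z]) (use wj 1 in auto)
  next
    case 2
    show thesis
      by (rule *[of rotation z]) (use wj 2 rotation_bij rotation_edge_iff in \<open>auto simp: rotation_def\<close>)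
  next
    case 3
    have "(rotation \<circ> rotation) ` e \<in> hedges D3 \<longleftrightarrow> e \<in> hedges D3" if "e \<subseteq> verts D3" for e
    proof -
      have "rotation ` e \<subseteq> verts D3"
        using that rotation_verts by blast
      then show ?thesis
        using that by (simp only: rotation_edge_iff image_comp[symmetric])
    qed
    then show thesis
      by (intro *[of "rotation \<circ> rotation" z] bij_betw_trans[OF rotation_bij rotation_bij])
        (use wj 3 in \<open>auto simp: rotation_def\<close>)
  qed
qed

lemma links_isomorphic:
  assumes "x \<in> verts D3" "y \<in> verts D3"
  shows "isomorphic (link_graph x D3) (link_graph y D3)"
proof -
  have standard: "isomorphic (link_graph x D3) (link_graph (2, origin) D3)" if x: "x \<in> verts D3" for x
  proof -
    obtain f where "bij_betw f (verts D3) (verts D3)" "f x = (2, origin)"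
      "\<And>u v. u \<in> verts D3 \<Longrightarrow> v \<in> verts D3 \<Longrightarrow>
        {x, u, v} \<in> hedges D3 \<longleftrightarrow> {(2, origin), f u, f v} \<in> hedges D3"
      using link_straightening[OF x] by blast
    then show ?thesis
      using isomorphic_link_graphs[OF _ x uniform uniform, of f] by simp
  qed
  show ?thesis
    using isomorphic_sym[OF standard[OF assms(2)] link_graph_wf[OF uniform]] standard[OF assms(1)]
    by (blast intro: isomorphic_trans)
qed

subsection \<open>Suspended cycles\<close>

text \<open>
  After straightening, the cycle lies in the link of the origin, which is bipartite between the first
  two parts. The vertices alternate between these parts.
\<close>

lemma closed_walk_at_origin:
  assumes "embeds (suspension (cycle_graph (2 * l))) D3" "l > 0"
  obtains a b where "inj_on a {..<l}" "inj_on b {..<l}" "a ` {..<l} \<subseteq> points" "b ` {..<l} \<subseteq> points"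
    "\<And>i. i < l \<Longrightarrow> incident (a i) (b i) origin"
    "\<And>i. i < l \<Longrightarrow> incident (a ((i + 1) mod l)) (b i) origin"
proof -
  note result = that
  let ?n = "2 * l"
  obtain w c where w: "w \<in> verts D3" and c: "inj_on c {..<?n}" "c ` {..<?n} \<subseteq> verts D3"
    and ce: "\<And>i. i < ?n \<Longrightarrow> {w, c i, c ((i + 1) mod ?n)} \<in> hedges D3"
    using embeds_suspension_cycleE[OF assms(1)] by metis
  obtain f where f: "bij_betw f (verts D3) (verts D3)" "f w = (2, origin)"
    and fe: "\<And>u v. u \<in> verts D3 \<Longrightarrow> v \<in> verts D3 \<Longrightarrow>
      {w, u, v} \<in> hedges D3 \<longleftrightarrow> {(2, origin), f u, f v} \<in> hedges D3"
    using link_straightening[OF w] by metis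
  have walk: thesis if d: "inj_on d {..<?n}" "d ` {..<?n} \<subseteq> verts D3" "fst (d 0) = 0"
    and de: "\<And>i. i < ?n \<Longrightarrow> {(2, origin), d i, d ((i + 1) mod ?n)} \<in> hedges D3" for d
  proof -
    have mem: "snd (d i) \<in> points" if "i < ?n" for i
      using d(2) that by (auto simp: D3_def image_subset_iff mem_Times_iff)
    have step: "(fst (d i) = 0 \<and> fst (d ((i + 1) mod ?n)) = 1 \<and>
          incident (snd (d i)) (snd (d ((i + 1) mod ?n))) origin) \<or>
        (fst (d i) = 1 \<and> fst (d ((i + 1) mod ?n)) = 0 \<and>
          incident (snd (d ((i + 1) mod ?n))) (snd (d i)) origin)" if "i < ?n" for i
      using de[OF that] edge_at_apex[OF origin_in_points mem[OF that] mem[of "(i + 1) mod ?n"],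
          of "fst (d i)" "fst (d ((i + 1) mod ?n))"] assms(2)
      by simp
    have parity: "fst (d i) = i mod 2" if "i < ?n" for i
      using that
    proof (induction i)
      case 0
      then show ?case using d(3) by simp
    next
      case (Suc i)
      then show ?case using step[of i] by (auto simp: mod_Suc)
    qed
    show thesis
    proof (rule result[of "\<lambda>i. snd (d (2 * i))" "\<lambda>i. snd (d (2 * i + 1))"])
      have inj: "i = j" if "i < ?n" "j < ?n" "i mod 2 = j mod 2" "snd (d i) = snd (d j)" for i j
        using that d(1) parity by (metis inj_on_def lessThan_iff prod_eqI)
      show "inj_on (\<lambda>i. snd (d (2 * i))) {..<l}" "inj_on (\<lambda>i. snd (d (2 * i + 1))) {..<l}"
        using inj[of "2 * _" "2 * _"] inj[of "2 * _ + 1" "2 * _ + 1"] by (auto simp: inj_on_def)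
      show "(\<lambda>i. snd (d (2 * i))) ` {..<l} \<subseteq> points" "(\<lambda>i. snd (d (2 * i + 1))) ` {..<l} \<subseteq> points"
        using mem by auto
      show "incident (snd (d (2 * i))) (snd (d (2 * i + 1))) origin" if "i < l" for i
        using step[of "2 * i"] parity[of "2 * i"] that by simp
      have m: "(2 * i + 1 + 1) mod ?n = 2 * ((i + 1) mod l)" for i
        using mult_mod_right[of 2 "i + 1" l] by (simp add: algebra_simps)
      show "incident (snd (d (2 * ((i + 1) mod l)))) (snd (d (2 * i + 1))) origin" if "i < l" for i
        using step[of "2 * i + 1", unfolded m] parity[of "2 * i + 1"] that by simp
    qed
  qed
  have fc: "inj_on (f \<circ> c) {..<?n}" "(f \<circ> c) ` {..<?n} \<subseteq> verts D3"
    using c f(1) by (auto simp: bij_betw_def inj_on_subset intro!: comp_inj_on)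
  have fce: "{(2, origin), (f \<circ> c) i, (f \<circ> c) ((i + 1) mod ?n)} \<in> hedges D3" if "i < ?n" for i
  proof -
    have "c i \<in> verts D3" "c ((i + 1) mod ?n) \<in> verts D3"
      using c(2) that assms(2) by (auto simp: image_subset_iff)
    then show ?thesis
      using ce[OF that] fe by simp
  qed
  show thesis
  proof (cases "fst ((f \<circ> c) 0) = 0")
    case True
    then show thesis
      using walk fc fce by blast
  next
    case False
    \<comment> \<open>If the cycle starts in the second part, start it one step later.\<close>
    let ?d = "\<lambda>i. (f \<circ> c) ((i + 1) mod ?n)"
    obtain j0 x0 j1 x1 where p: "(f \<circ> c) 0 = (j0, x0)" "(f \<circ> c) 1 = (j1, x1)" by force
    have "(f \<circ> c) 0 \<in> verts D3" "(f \<circ> c) 1 \<in> verts D3"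
      by (rule subsetD[OF fc(2) imageI]; use assms(2) in simp)+
    then have "x0 \<in> points" "x1 \<in> points"
      unfolding p by (simp_all add: D3_def)
    then have j1: "j1 = 0"
      using fce[of 0] False assms(2) edge_at_apex[OF origin_in_points, of x0 x1 j0 j1] p by auto
    have rot_inj: "i = j" if "(i + 1) mod ?n = (j + 1) mod ?n" "i < ?n" "j < ?n" for i j
      using that by (auto simp: mod_Suc split: if_splits)
    show thesis
    proof (rule walk[of ?d])
      show "inj_on ?d {..<?n}"
      proof (rule inj_onI)
        fix i j assume ij: "i \<in> {..<?n}" "j \<in> {..<?n}" "?d i = ?d j"
        have "(i + 1) mod ?n = (j + 1) mod ?n"
          by (rule inj_onD[OF fc(1) ij(3)]) (use assms(2) in simp_all)
        then show "i = j"
          by (rule rot_inj) (use ij(1,2) in simp_all)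
      qed
      show "?d ` {..<?n} \<subseteq> verts D3"
        by (intro image_subsetI subsetD[OF fc(2) imageI]) (use assms(2) in simp)
      have "(0 + 1) mod ?n = 1"
        using assms(2) by simp
      then show "fst (?d 0) = 0"
        by (simp only: p j1 fst_conv)
      show "{(2, origin), ?d i, ?d ((i + 1) mod ?n)} \<in> hedges D3" if "i < ?n" for i
        by (rule fce) (use assms(2) in simp)
    qed
  qed
qed

lemma neighbours_differ_in_first_coordinate:
  assumes "x \<in> points" "x' \<in> points" "x \<noteq> x'"
  shows "incident x y z \<Longrightarrow> incident x' y z \<Longrightarrow> x 0 \<noteq> x' 0"
    and "incident y x z \<Longrightarrow> incident y x' z \<Longrightarrow> x 0 \<noteq> x' 0"
  using completion_unique[OF assms(1,2)] assms(3) incident_rotate by metis+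

text \<open>
  Subtracting the equations of the two edges at \<open>b i\<close> eliminates the coordinates of \<open>b i\<close> other than
  the first. The resulting differences telescope around the cycle.
\<close>

lemma closed_walk_relations:
  assumes "embeds (suspension (cycle_graph (2 * l))) D3" "l \<ge> 2"
  obtains a b :: "nat \<Rightarrow> nat \<Rightarrow> 'f" where
    "\<And>i. i < l \<Longrightarrow> a i 0 \<noteq> a ((i + 1) mod l) 0" "\<And>i. i < l \<Longrightarrow> b i 0 \<noteq> b ((i + 1) mod l) 0"
    "\<And>i j. i < l \<Longrightarrow> 1 \<le> j \<Longrightarrow> j < k \<Longrightarrow>
      form j (a i) (b i) - form j (a ((i + 1) mod l)) (b i) = a i j - a ((i + 1) mod l) j"
proof -
  obtain a b where inj: "inj_on a {..<l}" "inj_on b {..<l}"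
    and mem: "a ` {..<l} \<subseteq> points" "b ` {..<l} \<subseteq> points"
    and e: "\<And>i. i < l \<Longrightarrow> incident (a i) (b i) origin"
      "\<And>i. i < l \<Longrightarrow> incident (a ((i + 1) mod l)) (b i) origin"
    using closed_walk_at_origin[OF assms(1)] assms(2) by (metis not_numeral_le_zero gr0I)
  show thesis
  proof (rule that[of a b])
    fix i assume i: "i < l"
    let ?i = "(i + 1) mod l"
    have i': "?i < l" "?i \<noteq> i"
      using assms(2) i by (auto simp: mod_Suc)
    have ne: "a i \<noteq> a ?i" "b i \<noteq> b ?i"
      using inj i i' by (metis inj_on_eq_iff lessThan_iff)+
    have pts: "a i \<in> points" "a ?i \<in> points" "b i \<in> points" "b ?i \<in> points"
      using mem i i' by blast+
    show "a i 0 \<noteq> a ?i 0"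
      using neighbours_differ_in_first_coordinate(1)[OF pts(1,2) ne(1)] e i by blast
    show "b i 0 \<noteq> b ?i 0"
      using neighbours_differ_in_first_coordinate(2)[OF pts(3,4) ne(2)] e i i' by blast
    show "form j (a i) (b i) - form j (a ?i) (b i) = a i j - a ?i j" if "1 \<le> j" "j < k" for j
    proof -
      have eq: "form j (a i) (b i) = a i j + b i j" "form j (a ?i) (b i) = a ?i j + b i j"
        using e[OF i] that unfolding incident_origin by auto
      show ?thesis
        unfolding eq by (rule add_diff_cancel_right)
    qed
  qed
qed

lemma no_suspended_hexagon:
  assumes "k \<ge> 3"
  shows "\<not> embeds (suspension (cycle_graph 6)) D3"
proof
  assume "embeds (suspension (cycle_graph 6)) D3"
  then obtain a b :: "nat \<Rightarrow> nat \<Rightarrow> 'f" where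
    a: "\<And>i. i < 3 \<Longrightarrow> a i 0 \<noteq> a ((i + 1) mod 3) 0" and
    b: "\<And>i. i < 3 \<Longrightarrow> b i 0 \<noteq> b ((i + 1) mod 3) 0" and
    step: "\<And>i j. i < 3 \<Longrightarrow> 1 \<le> j \<Longrightarrow> j < k \<Longrightarrow>
      form j (a i) (b i) - form j (a ((i + 1) mod 3)) (b i) = a i j - a ((i + 1) mod 3) j"
    using closed_walk_relations[of 3] by auto
  have c: "(0 + 1) mod 3 = (1::nat)" "(1 + 1) mod 3 = (2::nat)" "(2 + 1) mod 3 = (0::nat)"
    by simp_all
  note steps = step[of 0, unfolded c] step[of 1, unfolded c] step[of 2, unfolded c]
  show False
  proof (rule hexagon_elimination[of "a 0 0" "a 1 0" "a 2 0" "b 2 0" "b 0 0" "b 1 0"])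
    show "a 0 0 \<noteq> a 1 0" "a 2 0 \<noteq> a 0 0" "b 2 0 \<noteq> b 0 0"
      using a[of 0] a[of 2] b[of 2] by simp_all
    show "(a 0 0 - a 1 0) * b 0 0 + (a 1 0 - a 2 0) * b 1 0 + (a 2 0 - a 0 0) * b 2 0 = 0"
      using steps[of 1] assms by (simp add: form_def left_diff_distrib)
    show "((a 0 0)\<^sup>2 - (a 1 0)\<^sup>2) * b 0 0 + ((a 1 0)\<^sup>2 - (a 2 0)\<^sup>2) * b 1 0 +
        ((a 2 0)\<^sup>2 - (a 0 0)\<^sup>2) * b 2 0 = 0"
      using steps[of 2] assms by (simp add: form_def left_diff_distrib)
  qed
qed

lemma no_suspended_octagon:
  assumes "k \<ge> 5"
  shows "\<not> embeds (suspension (cycle_graph 8)) D3"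
proof
  assume "embeds (suspension (cycle_graph 8)) D3"
  then obtain a b :: "nat \<Rightarrow> nat \<Rightarrow> 'f" where
    a: "\<And>i. i < 4 \<Longrightarrow> a i 0 \<noteq> a ((i + 1) mod 4) 0" and
    b: "\<And>i. i < 4 \<Longrightarrow> b i 0 \<noteq> b ((i + 1) mod 4) 0" and
    step: "\<And>i j. i < 4 \<Longrightarrow> 1 \<le> j \<Longrightarrow> j < k \<Longrightarrow>
      form j (a i) (b i) - form j (a ((i + 1) mod 4)) (b i) = a i j - a ((i + 1) mod 4) j"
    using closed_walk_relations[of 4] by auto
  have c: "(0 + 1) mod 4 = (1::nat)" "(1 + 1) mod 4 = (2::nat)" "(2 + 1) mod 4 = (3::nat)"
    "(3 + 1) mod 4 = (0::nat)"
    by simp_all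
  note steps = step[of 0, unfolded c] step[of 1, unfolded c] step[of 2, unfolded c]
    step[of 3, unfolded c]
  show False
  proof (rule octagon_elimination[of "a 0 0" "a 1 0" "a 2 0" "a 3 0" "b 0 0" "b 1 0" "b 2 0" "b 3 0"
        "a 0 1" "a 1 1" "a 2 1" "a 3 1"])
    show "a 0 0 \<noteq> a 1 0" "a 1 0 \<noteq> a 2 0" "a 2 0 \<noteq> a 3 0"
      "b 0 0 \<noteq> b 1 0" "b 2 0 \<noteq> b 3 0" "b 3 0 \<noteq> b 0 0"
      using a[of 0, unfolded c] a[of 1, unfolded c] a[of 2, unfolded c]
        b[of 0, unfolded c] b[of 2, unfolded c] b[of 3, unfolded c] by simp_all
    show "a 0 1 - a 1 1 = (a 0 0 - a 1 0) * b 0 0" "a 1 1 - a 2 1 = (a 1 0 - a 2 0) * b 1 0"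
      "a 2 1 - a 3 1 = (a 2 0 - a 3 0) * b 2 0" "a 3 1 - a 0 1 = (a 3 0 - a 0 0) * b 3 0"
      using steps[of 1] assms by (simp_all add: form_def left_diff_distrib)
    show "((a 0 0)\<^sup>2 - (a 1 0)\<^sup>2) * b 0 0 + ((a 1 0)\<^sup>2 - (a 2 0)\<^sup>2) * b 1 0 +
        ((a 2 0)\<^sup>2 - (a 3 0)\<^sup>2) * b 2 0 + ((a 3 0)\<^sup>2 - (a 0 0)\<^sup>2) * b 3 0 = 0"
      using steps[of 2] assms by (simp add: form_def left_diff_distrib)
    show "(a 0 0 - a 1 0) * (b 0 0)\<^sup>2 + (a 1 0 - a 2 0) * (b 1 0)\<^sup>2 +
        (a 2 0 - a 3 0) * (b 2 0)\<^sup>2 + (a 3 0 - a 0 0) * (b 3 0)\<^sup>2 = 0"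
      using steps[of 3] assms by (simp add: form_def left_diff_distrib)
    show "(a 0 0 * b 0 0 * a 0 1 - a 1 0 * b 0 0 * a 1 1) +
        (a 1 0 * b 1 0 * a 1 1 - a 2 0 * b 1 0 * a 2 1) +
        (a 2 0 * b 2 0 * a 2 1 - a 3 0 * b 2 0 * a 3 1) +
        (a 3 0 * b 3 0 * a 3 1 - a 0 0 * b 3 0 * a 0 1) = 0"
      using steps[of 4] assms by (simp add: form_def)
  qed
qed

end

section \<open>The theorem\<close>

theorem theorem1p2:
  fixes q k m :: nat
  assumes "q = 3 ^ m" and "m \<ge> 1" and "k \<ge> 2"
  shows "\<exists>D :: nat hypergraph.
    uniform_hypergraph 3 D \<and> three_partite D \<and>
    (card (verts D) = 3 * q ^ k \<and> card (hedges D) = q ^ (2 * k + 1)) \<and>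
    (k \<le> 6 \<longrightarrow>
      (\<forall>x\<in>verts D. \<forall>y\<in>verts D. isomorphic (link_graph x D) (link_graph y D))) \<and>
    (k = 3 \<longrightarrow> is_free (suspension (cycle_graph 6)) D) \<and>
    (k = 5 \<longrightarrow> is_free (suspension (cycle_graph 8)) D)"
proof -
  obtain K :: "three mod_ring alg_closure set" where card_K: "card K = 3 ^ m"
    and closed: "\<And>x y. x \<in> K \<Longrightarrow> y \<in> K \<Longrightarrow> x + y \<in> K"
      "\<And>x y. x \<in> K \<Longrightarrow> y \<in> K \<Longrightarrow> x * y \<in> K" "\<And>x. x \<in> K \<Longrightarrow> - x \<in> K"
    using field_of_order_power_3[OF assms(2)] by metis
  have "finite K" "K \<noteq> {}"
    using card_K by (auto intro: card_ge_0_finite)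
  then interpret coordinate_field K k
    using closed assms(3) by unfold_locales
  obtain H :: "nat hypergraph" where H: "uniform_hypergraph 3 H" "three_partite H"
    and "card (verts H) = card (verts D3)" "card (hedges H) = card (hedges D3)"
    and links: "(\<And>x y. x \<in> verts D3 \<Longrightarrow> y \<in> verts D3 \<Longrightarrow>
        isomorphic (link_graph x D3) (link_graph y D3)) \<Longrightarrow>
      (\<forall>x\<in>verts H. \<forall>y\<in>verts H. isomorphic (link_graph x H) (link_graph y H))"
    and emb: "\<And>F :: nat option hypergraph. embeds F H \<Longrightarrow> embeds F D3"
    using copy_on_nat[OF finite_verts uniform tripartite, where ?'b = "nat option"] by blast
  moreover have "card (verts H) = 3 * q ^ k" "card (hedges H) = q ^ (2 * k + 1)"
    using calculation(3,4) card_verts card_edges card_K assms(1) by simp_all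
  moreover have "\<forall>x\<in>verts H. \<forall>y\<in>verts H. isomorphic (link_graph x H) (link_graph y H)"
    by (rule links) (rule links_isomorphic)
  moreover have "is_free (suspension (cycle_graph 6)) H" if "k = 3"
    using no_suspended_hexagon emb that by (intro is_free_if_not_embeds) auto
  moreover have "is_free (suspension (cycle_graph 8)) H" if "k = 5"
    using no_suspended_octagon emb that by (intro is_free_if_not_embeds) auto
  ultimately show ?thesis
    by blast
qed

end
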